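(* Let $(q_n)_{n\ge 0}$ be the associated Pell sequence. The only associated Pell numbers that can be expressed as the difference of two repdigits are $1,3,7,17$ and $41$. That is, for a positive integer $N$, the following are equivalent: (i) $N=q_n$ for some integer $n\ge 0$, and there exist integers $k,l\ge 1$ and $d_1,d_2\in\{1,\ldots,9\}$ such that $$N=d_1\left(\frac{10^k-1}{9}\right)-d_2\left(\frac{10^l-1}{9}\right);$$ (ii) $N\in\{1,3,7,17,41\}$. Representations are given by $q_0=q_1=1=9-8=8-7=7-6=6-5=5-4=4-3=3-2=2-1$, $q_2=3=11-8$, $q_3=7=11-4$, $q_4=17=22-5$, and $q_5=41=44-3$.
   Context: The associated Pell sequence $(q_n)_{n\ge 0}$ is defined by $q_0=1$, $q_1=1$ and $q_{n+1}=2q_n+q_{n-1}$ for $n\ge 1$. A repdigit is a positive integer of the form $d\,(10^k-1)/9$ with $d\in\{1,\ldots,9\}$ and $k\ge 1$ (so single nonzero digits, $k=1$, are included as repdigits). *)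

theory Defs
  imports Main
begin

fun assoc_pell :: "nat \<Rightarrow> int" where
  "assoc_pell 0 = 1"
| "assoc_pell (Suc 0) = 1"
| "assoc_pell (Suc (Suc n)) = 2 * assoc_pell (Suc n) + assoc_pell n"

text \<open>
  The number with \<open>k\<close> decimal digits all equal to \<open>d\<close>. It is a repdigit when
  \<open>1 \<le> d \<le> 9\<close> and \<open>k \<ge> 1\<close>; these bounds are imposed where it is used.
  The division is exact, see \<open>repdigit_exact\<close>.
\<close>
definition repdigit :: "int \<Rightarrow> nat \<Rightarrow> int" where
  "repdigit d k = d * ((10 ^ k - 1) div 9)"

lemma repdigit_exact: "9 * repdigit d k = d * (10 ^ k - 1)"
proof -
  have "(9::int) dvd 10 ^ k - 1"
  proof (induction k)
    case (Suc k)
    have "(10::int) ^ Suc k - 1 = 10 * (10 ^ k - 1) + 9" by simp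
    then show ?case using Suc by (metis dvd_add dvd_mult dvd_refl)
  qed simp
  then show ?thesis by (auto simp: repdigit_def)
qed

end

theory Submission
  imports Defs
begin

text \<open>
  Multiplying by 9 turns the equation into \<open>9 q\<^sub>n = d\<^sub>1 10\<^sup>k - d\<^sub>2 10\<^sup>l - (d\<^sub>1 - d\<^sub>2)\<close>, which is
  amenable to congruences alone; no lower bounds for linear forms in logarithms are needed.
  If \<open>l \<ge> 2\<close> (hence \<open>k \<ge> 2\<close>), then \<open>9 q\<^sub>n \<equiv> d\<^sub>2 - d\<^sub>1\<close> modulo 100, which leaves few values of
  \<open>n\<close> modulo 60, and these are excluded modulo \<open>1271 = 31 \<cdot> 41\<close>, where the Pell sequence has
  period 30 and 10 has order 15. If \<open>l = 1\<close> and \<open>k \<ge> 5\<close>, then \<open>9 q\<^sub>n \<equiv> - (d\<^sub>1 + 9 d\<^sub>2)\<close> modulo 800,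
  which has period 240; the remaining values of \<open>n\<close> are excluded modulo \<open>2651 = 11 \<cdot> 241\<close>, where
  the period is again 240 and 10 has order 30. The case \<open>l = 1\<close>, \<open>k \<le> 4\<close> is finite.
\<close>

section \<open>Periodic residues of the associated Pell sequence\<close>

text \<open>The final test for the pair \<open>(1, 1)\<close> makes a single run both check
  \<open>P\<close> and certify that the number of steps is a period.\<close>

fun pell_orbit_all :: "(int \<Rightarrow> bool) \<Rightarrow> int \<Rightarrow> nat \<Rightarrow> int \<Rightarrow> int \<Rightarrow> bool" where
  "pell_orbit_all P M 0 a b \<longleftrightarrow> a = 1 \<and> b = 1"
| "pell_orbit_all P M (Suc t) a b \<longleftrightarrow> P a \<and> pell_orbit_all P M t b ((2 * b + a) mod M)"

lemma pell_orbit_all_step: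
  assumes "pell_orbit_all P M t (assoc_pell n mod M) (assoc_pell (Suc n) mod M)"
  shows "i < t \<Longrightarrow> P (assoc_pell (n + i) mod M)"
    and "assoc_pell (n + t) mod M = 1 \<and> assoc_pell (Suc (n + t)) mod M = 1"
proof -
  have "(\<forall>i<t. P (assoc_pell (n + i) mod M)) \<and>
      assoc_pell (n + t) mod M = 1 \<and> assoc_pell (Suc (n + t)) mod M = 1"
    using assms
  proof (induction t arbitrary: n)
    case (Suc t)
    have "(2 * (assoc_pell (Suc n) mod M) + assoc_pell n mod M) mod M
        = assoc_pell (Suc (Suc n)) mod M"
      by (simp, rule mod_add_cong) (simp_all add: mod_simps)
    with Suc.prems have P: "P (assoc_pell n mod M)"
      and "pell_orbit_all P M t (assoc_pell (Suc n) mod M) (assoc_pell (Suc (Suc n)) mod M)"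
      by auto
    note IH = Suc.IH[OF this(2)]
    have "P (assoc_pell (n + i) mod M)" if "i < Suc t" for i
      using P IH that by (cases i) auto
    with IH show ?case by auto
  qed simp
  then show "i < t \<Longrightarrow> P (assoc_pell (n + i) mod M)"
    and "assoc_pell (n + t) mod M = 1 \<and> assoc_pell (Suc (n + t)) mod M = 1"
    by blast+
qed

text \<open>The orbit closes after \<open>T\<close> steps, so it restarts at every multiple of
  \<open>T\<close> and the \<open>T\<close> tested residues are all that occur.\<close>

lemma pell_orbit_all_imp:
  assumes orbit: "pell_orbit_all P M T 1 1" and "0 < T" and "1 < M"
  shows "P (assoc_pell n mod M)"
proof -
  have start: "assoc_pell (T * c) mod M = 1 \<and> assoc_pell (Suc (T * c)) mod M = 1" for c
  proof (induction c)
    case (Suc c)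
    with orbit pell_orbit_all_step(2)[of P M T "T * c"] show ?case
      by (simp add: add.commute)
  qed (use \<open>1 < M\<close> in simp)
  have "P (assoc_pell (T * (n div T) + n mod T) mod M)"
    by (rule pell_orbit_all_step(1)[where t = T]) (use start orbit \<open>0 < T\<close> in auto)
  then show ?thesis by simp
qed

section \<open>Residues of powers of 10 and the two sieves\<close>

lemma power_mod_mem:
  fixes b m :: int
  assumes "1 < m" and "1 \<in> X" and "\<And>x. x \<in> X \<Longrightarrow> b * x mod m \<in> X"
  shows "b ^ k mod m \<in> X"
proof (induction k)
  case (Suc k)
  from assms(3)[OF this] show ?case by (simp add: mod_simps)
qed (use assms(1,2) in simp)

text \<open>In the next definition \<open>r\<close> stands for \<open>8 + d\<^sub>1 - d\<^sub>2\<close>, which determines \<open>d\<^sub>2\<close> from \<open>d\<^sub>1\<close>.\<close>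

definition sieve_long :: "int list \<Rightarrow> int \<Rightarrow> bool" where
  "sieve_long X a \<longleftrightarrow> (let r = (8 - 9 * a) mod 100 in
     if r \<le> 16 then
       list_all (\<lambda>d1. let d2 = d1 + 8 - r in
         if 1 \<le> d2 \<and> d2 \<le> 9 then
           list_all (\<lambda>x. list_all (\<lambda>y. (d1 * x - d2 * y - 9 * a - (d1 - d2)) mod 1271 \<noteq> 0) X) X
         else True) [1, 2, 3, 4, 5, 6, 7, 8, 9]
     else True)"

text \<open>Here \<open>c\<close> stands for \<open>9 d\<^sub>2 + d\<^sub>1\<close>, which determines \<open>d\<^sub>1\<close>.\<close>

definition sieve_short :: "int list \<Rightarrow> int \<Rightarrow> bool" where
  "sieve_short X a \<longleftrightarrow> (let c = (- 9 * a) mod 800; d1 = (c - 1) mod 9 + 1 in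
     if 10 \<le> c \<and> c \<le> 90 then list_all (\<lambda>x. (d1 * x - 9 * a - c) mod 2651 \<noteq> 0) X
     else True)"

definition pow10_mod_1271 :: "int list" where
  "pow10_mod_1271 =
    [1, 10, 100, 1000, 1103, 862, 994, 1043, 262, 78, 780, 174, 469, 877, 1144]"

definition pow10_mod_2651 :: "int list" where
  "pow10_mod_2651 =
    [1, 10, 100, 1000, 2047, 1913, 573, 428, 1629, 384, 1189, 1286, 2256, 1352, 265,
     2650, 2641, 2551, 1651, 604, 738, 2078, 2223, 1022, 2267, 1462, 1365, 395, 1299, 2386]"

text \<open>The list is the full cycle generated by 10: its last entry satisfies
  \<open>10 * 1144 mod 1271 = 1\<close>.\<close>

lemma pow10_mod_1271: "10 ^ k mod 1271 \<in> set pow10_mod_1271"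
  by (rule power_mod_mem) (auto simp: pow10_mod_1271_def)

lemma pow10_mod_2651: "10 ^ k mod 2651 \<in> set pow10_mod_2651"
  by (rule power_mod_mem) (auto simp: pow10_mod_2651_def)

text \<open>The modulus \<open>127100 = 100 * 1271\<close> carries both residues that the sieve
  reads; in the next lemma \<open>2120800 = 800 * 2651\<close> does the same.\<close>

lemma sieve_long_orbit: "pell_orbit_all (sieve_long pow10_mod_1271) 127100 60 1 1"
  by code_simp

lemma sieve_short_orbit: "pell_orbit_all (sieve_short pow10_mod_2651) 2120800 240 1 1"
  by code_simp

section \<open>Exclusion of the infinite families of exponents\<close>

lemma no_solution_long:
  fixes d1 d2 :: int
  assumes d: "1 \<le> d1" "d1 \<le> 9" "1 \<le> d2" "d2 \<le> 9" and kl: "2 \<le> k" "2 \<le> l"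
  shows "9 * assoc_pell n \<noteq> d1 * 10 ^ k - d2 * 10 ^ l - (d1 - d2)"
proof
  assume eq: "9 * assoc_pell n = d1 * 10 ^ k - d2 * 10 ^ l - (d1 - d2)"
  define a where "a = assoc_pell n mod 127100"
  define x y :: int where "x = 10 ^ k mod 1271" and "y = 10 ^ l mod 1271"
  define s where "s = assoc_pell n div 127100"
  define u v :: int where "u = 10 ^ k div 1271" and "v = 10 ^ l div 1271"
  have q: "assoc_pell n = 127100 * s + a"
    and x: "10 ^ k = 1271 * u + x" and y: "10 ^ l = 1271 * v + y"
    by (simp_all add: a_def x_def y_def s_def u_def v_def)
  have ok: "sieve_long pow10_mod_1271 a"
    unfolding a_def by (rule pell_orbit_all_imp[OF sieve_long_orbit]) simp_all
  have "(100::int) dvd 10 ^ k" "(100::int) dvd 10 ^ l"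
    using kl le_imp_power_dvd[of 2 _ "10::int"] by auto
  then obtain K L :: int where "10 ^ k = 100 * K" "10 ^ l = 100 * L" by (auto elim!: dvdE)
  with eq q have "8 - 9 * a = (8 + d1 - d2) + 100 * (11439 * s - d1 * K + d2 * L)"
    by (simp add: algebra_simps)
  then have "(8 - 9 * a) mod 100 = (8 + d1 - d2) mod 100"
    by (simp only: mod_mult_self2)
  \<comment> \<open>The shift by 8 puts \<open>8 + d1 - d2\<close> between 0 and 16, so it is its
    own residue.\<close>
  then have r: "(8 - 9 * a) mod 100 = 8 + d1 - d2" using d by simp
  have xy: "x \<in> set pow10_mod_1271" "y \<in> set pow10_mod_1271"
    using pow10_mod_1271 by (auto simp: x_def y_def)
  have "\<forall>x\<in>set pow10_mod_1271. \<forall>y\<in>set pow10_mod_1271.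
      (d1 * x - d2 * y - 9 * a - (d1 - d2)) mod 1271 \<noteq> 0"
  proof -
    have "d1 \<in> set [1, 2, 3, 4, 5, 6, 7, 8, 9]" using d by auto
    moreover have "8 + d1 - d2 \<le> 16" "d1 + 8 - (8 + d1 - d2) = d2" using d by auto
    ultimately show ?thesis
      using ok d unfolding sieve_long_def Let_def r list_all_iff by (metis (no_types, lifting))
  qed
  from this[THEN bspec, OF xy(1), THEN bspec, OF xy(2)]
  have "(d1 * x - d2 * y - 9 * a - (d1 - d2)) mod 1271 \<noteq> 0" .
  moreover have "d1 * x - d2 * y - 9 * a - (d1 - d2) = 1271 * (900 * s - d1 * u + d2 * v)"
    using eq unfolding q x y by (simp add: algebra_simps)
  ultimately show False by simp
qed

lemma no_solution_short:
  fixes d1 d2 :: int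
  assumes d: "1 \<le> d1" "d1 \<le> 9" "1 \<le> d2" "d2 \<le> 9" and k: "5 \<le> k"
  shows "9 * assoc_pell n \<noteq> d1 * 10 ^ k - d2 * 10 - (d1 - d2)"
proof
  assume eq: "9 * assoc_pell n = d1 * 10 ^ k - d2 * 10 - (d1 - d2)"
  define a where "a = assoc_pell n mod 2120800"
  define x :: int where "x = 10 ^ k mod 2651"
  define s where "s = assoc_pell n div 2120800"
  define u :: int where "u = 10 ^ k div 2651"
  have q: "assoc_pell n = 2120800 * s + a" and x: "10 ^ k = 2651 * u + x"
    by (simp_all add: a_def x_def s_def u_def)
  have ok: "sieve_short pow10_mod_2651 a"
    unfolding a_def by (rule pell_orbit_all_imp[OF sieve_short_orbit]) simp_all
  have "(100000::int) dvd 10 ^ k"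
    using k le_imp_power_dvd[of 5 _ "10::int"] by auto
  \<comment> \<open>Since \<open>100000 = 800 * 125\<close>, the leading term vanishes modulo
    800.\<close>
  then obtain K :: int where "10 ^ k = 100000 * K" by (auto elim!: dvdE)
  with eq q have "- 9 * a = (9 * d2 + d1) + 800 * (23859 * s - d1 * (125 * K))"
    by (simp add: algebra_simps)
  then have "(- 9 * a) mod 800 = (9 * d2 + d1) mod 800"
    by (simp only: mod_mult_self2)
  then have c: "(- 9 * a) mod 800 = 9 * d2 + d1" using d by simp
  \<comment> \<open>As \<open>d1 - 1\<close> lies between 0 and 8, it is the remainder of
    \<open>9 * d2 + d1 - 1\<close> on division by 9.\<close>
  have "(9 * d2 + d1 - 1) mod 9 = (d1 - 1) mod 9"
    by (metis add_diff_eq mod_mult_self4)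
  then have d1: "(9 * d2 + d1 - 1) mod 9 + 1 = d1" using d by simp
  have "x \<in> set pow10_mod_2651" using pow10_mod_2651 by (simp add: x_def)
  then have "(d1 * x - 9 * a - (9 * d2 + d1)) mod 2651 \<noteq> 0"
    using ok d unfolding sieve_short_def Let_def c d1 list_all_iff by (auto split: if_splits)
  moreover have "d1 * x - 9 * a - (9 * d2 + d1) = 2651 * (7200 * s - d1 * u)"
    using eq unfolding q x by (simp add: algebra_simps)
  ultimately show False by simp
qed

section \<open>The remaining finite case and the equivalence\<close>

lemma assoc_pell_pos: "0 < assoc_pell n"
  by (induction n rule: assoc_pell.induct) auto

lemma assoc_pell_mono: "m \<le> n \<Longrightarrow> assoc_pell m \<le> assoc_pell n"
proof (rule lift_Suc_mono_le[of assoc_pell])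
  show "assoc_pell i \<le> assoc_pell (Suc i)" for i
    using assoc_pell_pos[of i] assoc_pell_pos[of "i - 1"] by (cases i) auto
qed

lemma assoc_pell_below_10000:
  assumes "assoc_pell n < 10000"
  shows "assoc_pell n \<in> {1, 3, 7, 17, 41, 99, 239, 577, 1393, 3363, 8119}"
proof -
  have "assoc_pell 12 = 19601" by code_simp
  with assms assoc_pell_mono[of 12 n] have "n < 12" by (cases "12 \<le> n") auto
  moreover have "list_all (\<lambda>i. assoc_pell i \<in> {1, 3, 7, 17, 41, 99, 239, 577, 1393, 3363, 8119}) [0..<12]"
    by code_simp
  ultimately show ?thesis unfolding list_all_iff by simp
qed

lemma assoc_pell_eq_diff_repdigits:
  assumes q: "assoc_pell n = repdigit d1 k - repdigit d2 l"
    and "1 \<le> k" "1 \<le> l" and d: "1 \<le> d1" "d1 \<le> 9" "1 \<le> d2" "d2 \<le> 9"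
  shows "assoc_pell n \<in> {1, 3, 7, 17, 41}"
proof -
  have eq: "9 * assoc_pell n = d1 * 10 ^ k - d2 * 10 ^ l - (d1 - d2)"
    using repdigit_exact[of d1 k] repdigit_exact[of d2 l] q by (simp add: algebra_simps)
  have "l = 1"
  proof (rule ccontr)
    assume "l \<noteq> 1"
    with \<open>1 \<le> l\<close> have l: "2 \<le> l" by simp
    have "k \<noteq> 1"
    proof
      assume "k = 1"
      \<comment> \<open>For \<open>k = 1\<close> the right side of \<open>eq\<close> is at most
        \<open>81 - 99\<close>, but Pell numbers are positive.\<close>
      have "(10::int) ^ 2 \<le> 10 ^ l" using l by (intro power_increasing) auto
      then have "1 * 99 \<le> d2 * (10 ^ l - 1)" using d by (intro mult_mono) auto
      with eq d \<open>k = 1\<close> assoc_pell_pos[of n] show False by (simp add: algebra_simps)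
    qed
    with no_solution_long[OF d _ l] eq \<open>1 \<le> k\<close> show False by force
  qed
  with no_solution_short[OF d] eq have "\<not> 5 \<le> k" by force
  with \<open>1 \<le> k\<close> have k: "k \<in> {1, 2, 3, 4}" by auto
  have D: "d1 \<in> {1, 2, 3, 4, 5, 6, 7, 8, 9}" using d by auto
  have "assoc_pell n < 10000" using eq d k \<open>l = 1\<close> by auto
  note assoc_pell_below_10000[OF this]
  \<comment> \<open>Once \<open>q\<close>, \<open>k\<close> and \<open>d1\<close> run through their
    finite sets, this is linear in \<open>d2\<close>, and the bounds on \<open>d2\<close> decide
    each case.\<close>
  moreover have "9 * assoc_pell n + d1 + 9 * d2 = d1 * 10 ^ k"
    using eq \<open>l = 1\<close> by simp
  ultimately show ?thesis
    using k D d(3,4) by (elim insertE emptyE) auto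
qed

theorem theorem5p1:
  shows "(\<forall>N::int. N > 0 \<longrightarrow>
      ((\<exists>n. N = assoc_pell n) \<and>
       (\<exists>k l :: nat. \<exists>d1 d2 :: int. k \<ge> 1 \<and> l \<ge> 1 \<and> d1 \<in> {1..9} \<and> d2 \<in> {1..9} \<and>
          N = repdigit d1 k - repdigit d2 l)
       \<longleftrightarrow> N \<in> {1, 3, 7, 17, 41}))
    \<and> (assoc_pell 0 = 1 \<and> assoc_pell 1 = 1 \<and> (\<forall>d\<in>{1..8}. 1 = repdigit (d + 1) 1 - repdigit d 1))
    \<and> (assoc_pell 2 = 3 \<and> 3 = repdigit 1 2 - repdigit 8 1)
    \<and> (assoc_pell 3 = 7 \<and> 7 = repdigit 1 2 - repdigit 4 1)
    \<and> (assoc_pell 4 = 17 \<and> 17 = repdigit 2 2 - repdigit 5 1)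
    \<and> (assoc_pell 5 = 41 \<and> 41 = repdigit 4 2 - repdigit 3 1)"
proof -
  have vals: "assoc_pell 0 = 1" "assoc_pell 1 = 1" "assoc_pell 2 = 3" "assoc_pell 3 = 7"
    "assoc_pell 4 = 17" "assoc_pell 5 = 41"
    by (simp_all add: numeral_eq_Suc)
  have reps: "(3::int) = repdigit 1 2 - repdigit 8 1" "7 = repdigit 1 2 - repdigit 4 1"
    "17 = repdigit 2 2 - repdigit 5 1" "41 = repdigit 4 2 - repdigit 3 1"
    and rep1: "1 = repdigit (d + 1) 1 - repdigit d 1" for d
    by (simp_all add: repdigit_def)
  have "(\<exists>n. N = assoc_pell n) \<and>
       (\<exists>k l :: nat. \<exists>d1 d2 :: int. k \<ge> 1 \<and> l \<ge> 1 \<and> d1 \<in> {1..9} \<and> d2 \<in> {1..9} \<and>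
          N = repdigit d1 k - repdigit d2 l)
       \<longleftrightarrow> N \<in> {1, 3, 7, 17, 41}" (is "?pell \<and> ?rep \<longleftrightarrow> _") for N
  proof
    assume "?pell \<and> ?rep"
    then show "N \<in> {1, 3, 7, 17, 41}"
      using assoc_pell_eq_diff_repdigits by (metis atLeastAtMost_iff)
  next
    assume N: "N \<in> {1, 3, 7, 17, 41}"
    then have ?pell using vals by (metis empty_iff insert_iff)
    moreover have ?rep if "N = repdigit d1 k - repdigit d2 1"
      "k \<ge> 1" "d1 \<in> {1..9}" "d2 \<in> {1..9}" for d1 d2 k
      using that by blast
    \<comment> \<open>The arguments are \<open>d1\<close>, \<open>k\<close>, \<open>d2\<close> in
      this order, giving 2 - 1, 11 - 8, 11 - 4, 22 - 5 and 44 - 3.\<close>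
    note this[of 2 1 1] this[of 1 2 8] this[of 1 2 4] this[of 2 2 5] this[of 4 2 3]
    with N reps rep1[of 1] have ?rep by auto
    ultimately show "?pell \<and> ?rep" ..
  qed
  with vals reps rep1 show ?thesis by blast
qed

end
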